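(* The axiomatization consisting of A1-4, WIF1-2 and WFE is sound and ground-complete for BCCS($A$) modulo $\simeq_{\rm WF}$. If $A$ is infinite, it is also $\omega$-complete. If $A$ is finite, the axiomatization becomes $\omega$-complete by adding the axiom FE3$'$ (which is sound modulo $\simeq_{\rm WF}$).
   Context: $A$ is a nonempty countable set of actions, $\tau\notin A$, $A_\tau=A\cup\{\tau\}$. BCCS($A$) terms: $t::=0\mid x\mid\alpha t\mid t+t$ ($x$ a variable, $\alpha\in A_\tau$). Transitions: $\alpha t\xrightarrow{\alpha}t$; if $t\xrightarrow{\alpha}t'$ then $t+u\xrightarrow{\alpha}t'$ and $u+t\xrightarrow{\alpha}t'$. $\Rightarrow$ is the reflexive-transitive closure of $\xrightarrow{\tau}$; $\mathcal{I}(s)=\{\alpha\in A_\tau\mid s\xrightarrow{\alpha}\}$. $(a_1\cdots a_k,B)$ with $B\subseteq A$ is a weak failure pair of closed $s$ if $s\Rightarrow\xrightarrow{a_1}\Rightarrow\cdots\xrightarrow{a_k}\Rightarrow s'$ with $\mathcal{I}(s')\subseteq A\setminus B$. $s_1\precsim_{\rm WF}s_2$ iff weak failure pairs of $s_1$ are those of $s_2$ and $s_1\xrightarrow{\tau}$ implies $s_2\xrightarrow{\tau}$; $\simeq_{\rm WF}$ is its kernel; on open terms $t\simeq_{\rm WF}u$ iff $\rho(t)\simeq_{\rm WF}\rho(u)$ for all closed substitutions $\rho$. Equational logic with reflexivity, symmetry, transitivity, substitution instances, closure under contexts; sound, ground-complete ($p\simeq_{\rm WF}q$ closed implies $p\approx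 q$ derivable), $\omega$-complete (derivability of all closed instances implies derivability). Axioms (action symbols range over all actions of $A$, $\alpha$ over $A_\tau$): A1: $x+y\approx y+x$; A2: $(x+y)+z\approx x+(y+z)$; A3: $x+x\approx x$; A4: $x+0\approx x$; WIF1: $\alpha(\tau x+\tau y)\approx\alpha x+\alpha y$; WIF2: $\tau x+y\approx\tau x+\tau(x+y)$; WFE: $ax+\tau(ay+z)\approx\tau(ax+ay+z)$; FE3$'$: $\tau(x+\sum_{b\in A}bz_b)+\tau(x+y+\sum_{b\in A}bz_b)\approx\tau(x+y+\sum_{b\in A}bz_b)$ with distinct variables $x,y,z_b$. *)

theory Defs
  imports "HOL-Library.Countable"
begin

text \<open>
  The action set \<open>A\<close> is the type \<open>'a\<close>, and \<open>'a act\<close> is \<open>A\<^sub>\<tau>\<close>; the set of variables is the type \<open>'v\<close>.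
\<close>

datatype 'a act = Tau | Act 'a

datatype (acts: 'a, vars: 'v) bccs =
    Zero
  | Var 'v
  | Pref "'a act" "('a, 'v) bccs" (infixr \<open>\<cdot>\<close> 75)
  | Plus "('a, 'v) bccs" "('a, 'v) bccs" (infixl \<open>\<oplus>\<close> 65)

definition closed_term :: "('a, 'v) bccs \<Rightarrow> bool" where
  "closed_term t \<longleftrightarrow> vars t = {}"

primrec subst :: "('v \<Rightarrow> ('a, 'w) bccs) \<Rightarrow> ('a, 'v) bccs \<Rightarrow> ('a, 'w) bccs" where
  "subst \<sigma> Zero = Zero"
| "subst \<sigma> (Var x) = \<sigma> x"
| "subst \<sigma> (\<alpha> \<cdot> t) = \<alpha> \<cdot> subst \<sigma> t"
| "subst \<sigma> (t \<oplus> u) = subst \<sigma> t \<oplus> subst \<sigma> u"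

definition closed_subst :: "('v \<Rightarrow> ('a, 'v) bccs) \<Rightarrow> bool" where
  "closed_subst \<rho> \<longleftrightarrow> (\<forall>x. closed_term (\<rho> x))"


subsection \<open>Operational semantics and weak failures\<close>

inductive step :: "('a, 'v) bccs \<Rightarrow> 'a act \<Rightarrow> ('a, 'v) bccs \<Rightarrow> bool" where
  pref: "step (\<alpha> \<cdot> t) \<alpha> t"
| plusL: "step t \<alpha> t' \<Longrightarrow> step (t \<oplus> u) \<alpha> t'"
| plusR: "step t \<alpha> t' \<Longrightarrow> step (u \<oplus> t) \<alpha> t'"

definition taus :: "('a, 'v) bccs \<Rightarrow> ('a, 'v) bccs \<Rightarrow> bool" where
  "taus = (\<lambda>s s'. step s Tau s')\<^sup>*\<^sup>*"

definition initials :: "('a, 'v) bccs \<Rightarrow> 'a act set" where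
  "initials s = {\<alpha>. \<exists>s'. step s \<alpha> s'}"

primrec weak_steps :: "'a list \<Rightarrow> ('a, 'v) bccs \<Rightarrow> ('a, 'v) bccs \<Rightarrow> bool" where
  "weak_steps [] s s' \<longleftrightarrow> taus s s'"
| "weak_steps (a # as) s s' \<longleftrightarrow>
     (\<exists>s1 s2. taus s s1 \<and> step s1 (Act a) s2 \<and> weak_steps as s2 s')"

definition weak_failures :: "('a, 'v) bccs \<Rightarrow> ('a list \<times> 'a set) set" where
  "weak_failures s = {(as, B). \<exists>s'. weak_steps as s s' \<and> initials s' \<subseteq> Act ` (UNIV - B)}"

text \<open>The relations \<open>wf_le\<close> and \<open>wf_kernel\<close> are only meaningful on closed terms.\<close>

definition wf_le :: "('a, 'v) bccs \<Rightarrow> ('a, 'v) bccs \<Rightarrow> bool" where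
  "wf_le s1 s2 \<longleftrightarrow> weak_failures s1 \<subseteq> weak_failures s2 \<and>
     ((\<exists>s'. step s1 Tau s') \<longrightarrow> (\<exists>s'. step s2 Tau s'))"

definition wf_kernel :: "('a, 'v) bccs \<Rightarrow> ('a, 'v) bccs \<Rightarrow> bool" where
  "wf_kernel s1 s2 \<longleftrightarrow> wf_le s1 s2 \<and> wf_le s2 s1"

definition wf_eq :: "('a, 'v) bccs \<Rightarrow> ('a, 'v) bccs \<Rightarrow> bool" where
  "wf_eq t u \<longleftrightarrow> (\<forall>\<rho>. closed_subst \<rho> \<longrightarrow> wf_kernel (subst \<rho> t) (subst \<rho> u))"


subsection \<open>Equational logic\<close>

type_synonym ('a, 'v) eqns = "(('a, 'v) bccs \<times> ('a, 'v) bccs) set"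

inductive derivable :: "('a, 'v) eqns \<Rightarrow> ('a, 'v) bccs \<Rightarrow> ('a, 'v) bccs \<Rightarrow> bool"
  for E :: "('a, 'v) eqns" where
  inst: "(t, u) \<in> E \<Longrightarrow> derivable E (subst \<sigma> t) (subst \<sigma> u)"
| refl: "derivable E t t"
| sym: "derivable E t u \<Longrightarrow> derivable E u t"
| trans: "derivable E t u \<Longrightarrow> derivable E u v \<Longrightarrow> derivable E t v"
| cong_Pref: "derivable E t u \<Longrightarrow> derivable E (\<alpha> \<cdot> t) (\<alpha> \<cdot> u)"
| cong_Plus: "derivable E t u \<Longrightarrow> derivable E t' u' \<Longrightarrow> derivable E (t \<oplus> t') (u \<oplus> u')"

definition sound_WF :: "('a, 'v) eqns \<Rightarrow> bool" where
  "sound_WF E \<longleftrightarrow> (\<forall>t u. derivable E t u \<longrightarrow> wf_eq t u)"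

definition ground_complete_WF :: "('a, 'v) eqns \<Rightarrow> bool" where
  "ground_complete_WF E \<longleftrightarrow>
     (\<forall>p q. closed_term p \<longrightarrow> closed_term q \<longrightarrow> wf_kernel p q \<longrightarrow> derivable E p q)"

definition omega_complete :: "('a, 'v) eqns \<Rightarrow> bool" where
  "omega_complete E \<longleftrightarrow>
     (\<forall>t u. (\<forall>\<rho>. closed_subst \<rho> \<longrightarrow> derivable E (subst \<rho> t) (subst \<rho> u)) \<longrightarrow> derivable E t u)"


subsection \<open>Axioms\<close>

text \<open>
  Each axiom is given as the set of its variants, one for every choice of distinct variables.
  These sets are nonempty only if \<open>'v\<close> has sufficiently many elements.
\<close>

definition A1 :: "('a, 'v) eqns" where
  "A1 = {(Var x \<oplus> Var y, Var y \<oplus> Var x) | x y. distinct [x, y]}"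

definition A2 :: "('a, 'v) eqns" where
  "A2 = {((Var x \<oplus> Var y) \<oplus> Var z, Var x \<oplus> (Var y \<oplus> Var z)) | x y z. distinct [x, y, z]}"

definition A3 :: "('a, 'v) eqns" where
  "A3 = {(Var x \<oplus> Var x, Var x) | x. True}"

definition A4 :: "('a, 'v) eqns" where
  "A4 = {(Var x \<oplus> Zero, Var x) | x. True}"

definition WIF1 :: "('a, 'v) eqns" where
  "WIF1 = {(\<alpha> \<cdot> (Tau \<cdot> Var x \<oplus> Tau \<cdot> Var y), \<alpha> \<cdot> Var x \<oplus> \<alpha> \<cdot> Var y) | \<alpha> x y. distinct [x, y]}"

definition WIF2 :: "('a, 'v) eqns" where
  "WIF2 = {(Tau \<cdot> Var x \<oplus> Var y, Tau \<cdot> Var x \<oplus> Tau \<cdot> (Var x \<oplus> Var y)) | x y. distinct [x, y]}"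

definition WFE :: "('a, 'v) eqns" where
  "WFE = {(Act a \<cdot> Var x \<oplus> Tau \<cdot> (Act a \<cdot> Var y \<oplus> Var z),
           Tau \<cdot> (Act a \<cdot> Var x \<oplus> Act a \<cdot> Var y \<oplus> Var z)) | a x y z. distinct [x, y, z]}"

definition WF_axioms :: "('a, 'v) eqns" where
  "WF_axioms = A1 \<union> A2 \<union> A3 \<union> A4 \<union> WIF1 \<union> WIF2 \<union> WFE"

text \<open>
  The sum over all actions is taken along an enumeration of \<open>'a\<close> (so it exists only for finite \<open>'a\<close>);
  the order of the summands and the trailing \<open>Zero\<close> are immaterial modulo \<open>A1\<close>, \<open>A2\<close>, \<open>A4\<close>.
\<close>

definition sum_terms :: "('a, 'v) bccs list \<Rightarrow> ('a, 'v) bccs" where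
  "sum_terms ts = foldr (\<oplus>) ts Zero"

definition pref_sum :: "'a list \<Rightarrow> ('a \<Rightarrow> 'v) \<Rightarrow> ('a, 'v) bccs" where
  "pref_sum bs z = sum_terms (map (\<lambda>b. Act b \<cdot> Var (z b)) bs)"

definition FE3' :: "('a, 'v) eqns" where
  "FE3' = {(Tau \<cdot> (Var x \<oplus> pref_sum bs z) \<oplus> Tau \<cdot> (Var x \<oplus> Var y \<oplus> pref_sum bs z),
            Tau \<cdot> (Var x \<oplus> Var y \<oplus> pref_sum bs z)) | x y z bs.
            distinct bs \<and> set bs = UNIV \<and> x \<noteq> y \<and> inj z \<and> x \<notin> range z \<and> y \<notin> range z}"

end

theory Submission
  imports Defs
begin

text \<open>
  Write \<open>t \<sqsubseteq> u\<close> if \<open>t \<oplus> u \<approx> u\<close> is derivable. All completeness claims come from one statement on open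
  terms: if every variable occurrence, trace and acceptance set of \<open>t\<close> is matched by \<open>u\<close>, then
  \<open>Tau \<cdot> t \<sqsubseteq> Tau \<cdot> u\<close>. By induction on \<open>t\<close>, each summand of \<open>t\<close> lies below \<open>Tau \<cdot> u\<close>, because \<open>WIF1\<close>
  merges all weak \<open>a\<close>-derivatives of \<open>u\<close> into one. For stable \<open>t\<close>, take a stable
  \<open>\<tau>\<close>-derivative \<open>s\<close> of \<open>u\<close> offering no more than \<open>t\<close>; then \<open>WIF2\<close> yields \<open>Tau \<cdot> (t \<oplus> s) \<sqsubseteq> Tau \<cdot> u\<close>, and
  \<open>WFE\<close> yields \<open>Tau \<cdot> t \<sqsubseteq> Tau \<cdot> t \<oplus> s \<approx> Tau \<cdot> (t \<oplus> s)\<close>. If \<open>t\<close> offers all of \<open>A\<close>, then \<open>s\<close> may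
  offer variables that \<open>t\<close> does not, and \<open>FE3'\<close> takes over. The matching condition follows from
  weak failures equivalence of the closed instances that map each variable to \<open>Zero\<close> or to a long
  power of one action.
\<close>

section \<open>Transitions and weak failures\<close>

lemma step_simps [simp]:
  "\<not> step Zero \<alpha> s"
  "\<not> step (Var x) \<alpha> s"
  "step (\<beta> \<cdot> t) \<alpha> s \<longleftrightarrow> \<alpha> = \<beta> \<and> s = t"
  "step (t \<oplus> u) \<alpha> s \<longleftrightarrow> step t \<alpha> s \<or> step u \<alpha> s"
  by (auto elim: step.cases intro: step.intros)

lemma size_step: "step t \<alpha> s \<Longrightarrow> size s < size t"
  by (induction rule: step.induct) auto

lemma initials_simps [simp]:
  "initials Zero = {}"
  "initials (Var x) = {}"
  "initials (\<alpha> \<cdot> t) = {\<alpha>}"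
  "initials (t \<oplus> u) = initials t \<union> initials u"
  by (auto simp: initials_def)

lemma finite_initials: "finite (initials t)"
  by (induction t) auto

text \<open>Variables have no transitions, so \<open>initials\<close> cannot see them. This is the
  counterpart of \<open>initials\<close> for unguarded variables.\<close>

primrec topvars :: "('a, 'v) bccs \<Rightarrow> 'v set" where
  "topvars Zero = {}"
| "topvars (Var x) = {x}"
| "topvars (\<alpha> \<cdot> t) = {}"
| "topvars (t \<oplus> u) = topvars t \<union> topvars u"

definition stable :: "('a, 'v) bccs \<Rightarrow> bool" where
  "stable s \<longleftrightarrow> (\<nexists>s'. step s Tau s')"

lemma stable_simps [simp]:
  "stable Zero"
  "stable (Var x)"
  "stable (\<alpha> \<cdot> t) \<longleftrightarrow> \<alpha> \<noteq> Tau"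
  "stable (t \<oplus> u) \<longleftrightarrow> stable t \<and> stable u"
  by (auto simp: stable_def)

lemma stable_iff_initials: "stable s \<longleftrightarrow> Tau \<notin> initials s"
  by (auto simp: stable_def initials_def)

text \<open>\<open>Tau\<close> lies outside the range of \<open>Act\<close>, so a state witnessing a
  failure pair must be stable; this is split off from the refusal proper.\<close>

lemma initials_subset_iff: "initials s \<subseteq> Act ` (UNIV - B) \<longleftrightarrow> stable s \<and> initials s \<inter> Act ` B = {}"
proof -
  have *: "\<alpha> \<in> Act ` (UNIV - B) \<longleftrightarrow> \<alpha> \<noteq> Tau \<and> \<alpha> \<notin> Act ` B" for \<alpha> :: "'a act"
    by (cases \<alpha>) auto
  show ?thesis
    unfolding stable_iff_initials subset_iff disjoint_iff * by metis
qed

text \<open>A \<open>Tau\<close> step shrinks a term, so only finitely many terms are reached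
  silently. Hence all weak derivatives after one action fit into a single sum.\<close>

lemma finite_weak_derivatives:
  fixes t :: "('a, 'v) bccs"
  shows "finite {s'. \<exists>s. taus t s \<and> step s \<alpha> s'}"
proof -
  have fin: "finite {s. step t \<alpha> s}" for t :: "('a, 'v) bccs" and \<alpha>
    by (induction t) (auto simp: Collect_disj_eq)
  have "finite {s. taus t s}"
  proof (induction t rule: measure_induct_rule[where f = size])
    case (less t)
    have "{s. taus t s} = insert t (\<Union>t' \<in> {t'. step t Tau t'}. {s. taus t' s})"
      unfolding taus_def by (auto intro: converse_rtranclp_into_rtranclp elim: converse_rtranclpE)
    then show ?case
      using less fin[of t Tau] by (simp add: size_step)
  qed
  moreover have "{s'. \<exists>s. taus t s \<and> step s \<alpha> s'} = (\<Union>s \<in> {s. taus t s}. {s'. step s \<alpha> s'})"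
    by auto
  ultimately show ?thesis
    using fin by auto
qed

lemma taus_refl [simp]: "taus s s"
  by (simp add: taus_def)

lemma taus_step: "step s Tau s' \<Longrightarrow> taus s' s'' \<Longrightarrow> taus s s''"
  by (simp add: taus_def converse_rtranclp_into_rtranclp)

lemma topvars_subset_vars: "topvars t \<subseteq> vars t"
  by (induction t) auto

lemma vars_step: "step t \<alpha> t' \<Longrightarrow> vars t' \<subseteq> vars t"
  by (induction rule: step.induct) auto

lemma vars_taus: "taus t t' \<Longrightarrow> vars t' \<subseteq> vars t"
  unfolding taus_def by (induction rule: rtranclp_induct) (auto dest: vars_step)

lemma taus_unfold: "taus s s' \<longleftrightarrow> s' = s \<or> (\<exists>s1. step s Tau s1 \<and> taus s1 s')"
  unfolding taus_def by (auto intro: converse_rtranclp_into_rtranclp elim: converse_rtranclpE)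

lemma taus_trans: "taus s s' \<Longrightarrow> taus s' s'' \<Longrightarrow> taus s s''"
  by (simp add: taus_def)

lemma taus_stable: "stable s \<Longrightarrow> taus s s' \<longleftrightarrow> s' = s"
  unfolding taus_def stable_def by (auto elim: converse_rtranclpE)

lemma weak_steps_taus: "taus s s' \<Longrightarrow> weak_steps as s' s'' \<Longrightarrow> weak_steps as s s''"
  by (cases as) (auto intro: taus_trans)

lemma weak_steps_append:
  "weak_steps as s s' \<Longrightarrow> weak_steps bs s' s'' \<Longrightarrow> weak_steps (as @ bs) s s''"
  by (induction as arbitrary: s) (simp add: weak_steps_taus, fastforce)

lemma weak_steps_step: "step s (Act a) s' \<Longrightarrow> weak_steps as s' s'' \<Longrightarrow> weak_steps (a # as) s s''"
  by (auto intro: exI[of _ s])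

text \<open>Every transition shrinks the term. A later test for variables uses a trace that exceeds
  this bound.\<close>

lemma weak_steps_length:
  fixes s :: "('a, 'v) bccs"
  shows "weak_steps as s s' \<Longrightarrow> length as < size s + 1"
proof -
  have taus: "size s' \<le> size s" if "taus s s'" for s s' :: "('a, 'v) bccs"
    using that unfolding taus_def by (induction rule: rtranclp_induct) (auto dest: size_step)
  show "weak_steps as s s' \<Longrightarrow> length as < size s + 1"
    by (induction as arbitrary: s) (fastforce dest: taus size_step)+
qed

lemma ex_stable_taus: "\<exists>s'. taus s s' \<and> stable s'"
proof (induction s rule: measure_induct_rule[where f = size])
  case (less s)
  show ?case
  proof (cases "stable s")
    case False
    then obtain s' where "step s Tau s'"
      by (auto simp: stable_def)
    with less show ?thesis
      by (blast intro: size_step taus_step)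
  qed (blast intro: taus_refl)
qed

section \<open>Weak failures by cases on the first transition\<close>

lemma Nil_weak_failures:
  fixes s :: "('a, 'v) bccs"
  shows "([], B) \<in> weak_failures s \<longleftrightarrow>
     (stable s \<and> initials s \<inter> Act ` B = {}) \<or> (\<exists>s'. step s Tau s' \<and> ([], B) \<in> weak_failures s')"
proof -
  have *: "([], B) \<in> weak_failures s \<longleftrightarrow>
      (\<exists>s'. taus s s' \<and> stable s' \<and> initials s' \<inter> Act ` B = {})" for s :: "('a, 'v) bccs"
    by (simp add: weak_failures_def initials_subset_iff)
  show ?thesis
    unfolding * by (subst taus_unfold) blast
qed

lemma Cons_weak_failures:
  "(a # as, B) \<in> weak_failures s \<longleftrightarrow>
     (\<exists>s'. step s (Act a) s' \<and> (as, B) \<in> weak_failures s') \<or>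
     (\<exists>s'. step s Tau s' \<and> (a # as, B) \<in> weak_failures s')"
  unfolding weak_failures_def mem_Collect_eq prod.case weak_steps.simps
  by (subst taus_unfold) blast

lemma weak_failures_Pref [simp]:
  "weak_failures (Tau \<cdot> t) = weak_failures t"
  "([], B) \<in> weak_failures (Act a \<cdot> t) \<longleftrightarrow> a \<notin> B"
  "(b # as, B) \<in> weak_failures (Act a \<cdot> t) \<longleftrightarrow> b = a \<and> (as, B) \<in> weak_failures t"
proof -
  have "(as, B) \<in> weak_failures (Tau \<cdot> t) \<longleftrightarrow> (as, B) \<in> weak_failures t" for as B
    by (cases as)
      (simp_all add: Nil_weak_failures[of _ "Tau \<cdot> t"] Cons_weak_failures[of _ _ _ "Tau \<cdot> t"])
  then show "weak_failures (Tau \<cdot> t) = weak_failures t"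
    by auto
qed (auto simp: Nil_weak_failures[of _ "Act a \<cdot> t"] Cons_weak_failures[of _ _ _ "Act a \<cdot> t"])

lemma weak_failures_Zero [simp]: "(as, B) \<in> weak_failures Zero \<longleftrightarrow> as = []"
  by (cases as) (simp_all add: Nil_weak_failures[of _ Zero] Cons_weak_failures[of _ _ _ Zero])

lemma Cons_weak_failures_Plus [simp]:
  "(a # as, B) \<in> weak_failures (t \<oplus> u) \<longleftrightarrow>
     (a # as, B) \<in> weak_failures t \<or> (a # as, B) \<in> weak_failures u"
  using Cons_weak_failures[of a as B t] Cons_weak_failures[of a as B u]
    Cons_weak_failures[of a as B "t \<oplus> u"] by auto

text \<open>A stable sum refuses what both summands refuse. Otherwise a \<open>Tau\<close> step must
  resolve the choice first, so only unstable summands contribute.\<close>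

lemma Nil_weak_failures_Plus [simp]:
  fixes t u :: "('a, 'v) bccs"
  shows "([], B) \<in> weak_failures (t \<oplus> u) \<longleftrightarrow>
     (if stable t \<and> stable u then ([], B) \<in> weak_failures t \<and> ([], B) \<in> weak_failures u
      else (\<not> stable t \<and> ([], B) \<in> weak_failures t) \<or> (\<not> stable u \<and> ([], B) \<in> weak_failures u))"
proof -
  \<comment> \<open>\<open>F\<close> isolates refusals reached after at least one \<open>Tau\<close>
    step; these distribute over sums.\<close>
  define F where "F s \<longleftrightarrow> (\<exists>s'. step s Tau s' \<and> ([], B) \<in> weak_failures s')" for s :: "('a, 'v) bccs"
  have F: "([], B) \<in> weak_failures s \<longleftrightarrow> stable s \<and> initials s \<inter> Act ` B = {} \<or> F s"
    "stable s \<Longrightarrow> \<not> F s" "F (t \<oplus> u) \<longleftrightarrow> F t \<or> F u" for s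
    unfolding F_def by (rule Nil_weak_failures) (auto simp: stable_def)
  show ?thesis
    unfolding F(1,3) stable_simps initials_simps Int_Un_distrib2 Un_empty using F(2) by meson
qed

lemma empty_refusal: "([], {}) \<in> weak_failures s"
proof (induction s rule: measure_induct_rule[where f = size])
  case (less s)
  show ?case
  proof (cases "stable s")
    case True
    then show ?thesis
      by (subst Nil_weak_failures) simp
  next
    case False
    then obtain s' where "step s Tau s'"
      by (auto simp: stable_def)
    with less show ?thesis
      by (subst Nil_weak_failures) (blast intro: size_step)
  qed
qed

section \<open>Soundness\<close>

lemma wf_kernel_iff:
  "wf_kernel s t \<longleftrightarrow> weak_failures s = weak_failures t \<and> (stable s \<longleftrightarrow> stable t)"
  by (auto simp: wf_kernel_def wf_le_def stable_def)

lemma wf_kernelI: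
  assumes "\<And>B. ([], B) \<in> weak_failures s \<longleftrightarrow> ([], B) \<in> weak_failures t"
    and "\<And>a as B. (a # as, B) \<in> weak_failures s \<longleftrightarrow> (a # as, B) \<in> weak_failures t"
    and "stable s \<longleftrightarrow> stable t"
  shows "wf_kernel s t"
proof -
  have "(as, B) \<in> weak_failures s \<longleftrightarrow> (as, B) \<in> weak_failures t" for as B
    using assms by (cases as) auto
  then show ?thesis
    using assms(3) by (auto simp: wf_kernel_iff)
qed

lemma wf_kernel_Pref: "wf_kernel s t \<Longrightarrow> wf_kernel (\<alpha> \<cdot> s) (\<alpha> \<cdot> t)"
  by (cases \<alpha>; rule wf_kernelI) (simp_all add: wf_kernel_iff)

text \<open>Here the stability clause of the equivalence enters: the empty-trace failures of a sum
  depend on which summands are stable.\<close>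

lemma wf_kernel_Plus:
  "wf_kernel s t \<Longrightarrow> wf_kernel s' t' \<Longrightarrow> wf_kernel (s \<oplus> s') (t \<oplus> t')"
  by (rule wf_kernelI) (simp_all add: wf_kernel_iff)

lemma subst_subst: "subst \<rho> (subst \<sigma> t) = subst (\<lambda>x. subst \<rho> (\<sigma> x)) t"
  by (induction t) auto

lemma subst_closed: "closed_term t \<Longrightarrow> subst \<rho> t = t"
  by (induction t) (auto simp: closed_term_def)

text \<open>The equivalence is a congruence, and a substituted axiom instance is again an instance,
  so checking the axioms suffices.\<close>

lemma sound_WFI:
  fixes E :: "('a, 'v) eqns"
  assumes "\<And>t u (\<rho> :: 'v \<Rightarrow> ('a, 'v) bccs). (t, u) \<in> E \<Longrightarrow> wf_kernel (subst \<rho> t) (subst \<rho> u)"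
  shows "sound_WF E"
proof -
  have "wf_kernel (subst \<rho> t) (subst \<rho> u)" if "derivable E t u" for t u and \<rho> :: "'v \<Rightarrow> ('a, 'v) bccs"
    using that
  proof induction
    case (inst t u \<sigma>)
    with assms show ?case
      by (simp add: subst_subst)
  qed (auto simp: wf_kernel_Pref wf_kernel_Plus, auto simp: wf_kernel_iff)
  then show ?thesis
    by (simp add: sound_WF_def wf_eq_def)
qed

lemma wf_kernel_WF_axioms:
  assumes "(t, u) \<in> WF_axioms"
  shows "wf_kernel (subst \<rho> t) (subst \<rho> u)"
proof -
  have "wf_kernel (subst \<rho> t) (subst \<rho> u)" if "(t, u) \<in> WIF1"
    using that unfolding WIF1_def
  proof clarsimp
    fix \<alpha> x y
    show "wf_kernel (\<alpha> \<cdot> (Tau \<cdot> \<rho> x \<oplus> Tau \<cdot> \<rho> y)) (\<alpha> \<cdot> \<rho> x \<oplus> \<alpha> \<cdot> \<rho> y)"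
    proof (cases \<alpha>)
      case (Act a)
      have "(as, B) \<in> weak_failures (Tau \<cdot> \<rho> x \<oplus> Tau \<cdot> \<rho> y) \<longleftrightarrow>
          (as, B) \<in> weak_failures (\<rho> x) \<or> (as, B) \<in> weak_failures (\<rho> y)" for as B
        by (cases as) auto
      with Act show ?thesis
        by (auto intro!: wf_kernelI)
    qed (auto intro!: wf_kernelI)
  qed
  with assms show ?thesis
    unfolding WF_axioms_def A1_def A2_def A3_def A4_def WIF2_def WFE_def
    by (elim UnE) (auto intro!: wf_kernelI split: if_splits)
qed

lemma subst_sum_terms: "subst \<sigma> (sum_terms ts) = sum_terms (map (subst \<sigma>) ts)"
  by (induction ts) (auto simp: sum_terms_def)

lemma step_sum_terms: "step (sum_terms ts) \<alpha> s \<longleftrightarrow> (\<exists>t \<in> set ts. step t \<alpha> s)"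
  by (induction ts) (auto simp: sum_terms_def)

lemma topvars_sum_terms: "topvars (sum_terms ts) = (\<Union>t \<in> set ts. topvars t)"
  by (induction ts) (auto simp: sum_terms_def)

text \<open>For stable \<open>\<rho> x\<close>, the sum over all of \<open>A\<close> leaves only the
  empty set to refuse, and \<open>empty_refusal\<close> gives that on the right as well. For
  unstable \<open>\<rho> x\<close>, its refusals survive the addition of
  \<open>\<rho> y\<close>.\<close>

lemma wf_kernel_FE3':
  assumes "(t, u) \<in> FE3'"
  shows "wf_kernel (subst \<rho> t) (subst \<rho> u)"
proof -
  obtain x y z bs where bs: "set bs = (UNIV :: 'a set)"
    and tu: "t = Tau \<cdot> (Var x \<oplus> pref_sum bs z) \<oplus> Tau \<cdot> (Var x \<oplus> Var y \<oplus> pref_sum bs z)"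
      "u = Tau \<cdot> (Var x \<oplus> Var y \<oplus> pref_sum bs z)"
    using assms by (auto simp: FE3'_def)
  define p where "p = subst \<rho> (pref_sum bs z)"
  have p: "stable p" and init: "initials p = range Act"
    by (auto simp: p_def pref_sum_def subst_sum_terms stable_def initials_def step_sum_terms bs)
  have F: "([], B) \<in> weak_failures p \<longleftrightarrow> B = {}" for B
  proof -
    have "\<not> step p Tau s" for s
      using p by (simp add: stable_def)
    then show ?thesis
      unfolding Nil_weak_failures[of B p] init using p by auto
  qed
  have
    "wf_kernel (Tau \<cdot> (\<rho> x \<oplus> p) \<oplus> Tau \<cdot> (\<rho> x \<oplus> \<rho> y \<oplus> p)) (Tau \<cdot> (\<rho> x \<oplus> \<rho> y \<oplus> p))"
    by (rule wf_kernelI) (auto simp: p F empty_refusal)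
  then show ?thesis
    by (simp add: tu p_def)
qed

section \<open>Equational reasoning\<close>

text \<open>\<open>E\<close> stays abstract so that one development serves the axioms with and
  without \<open>FE3'\<close>. Infinitely many variables supply the distinct ones in which the
  axioms are stated.\<close>

locale wf_theory =
  fixes E :: "('a::countable, 'v) eqns"
  assumes WF_axioms_subset: "WF_axioms \<subseteq> E"
    and infinite_variables: "infinite (UNIV :: 'v set)"
begin

abbreviation eqv (infix \<open>\<approx>\<close> 50) where
  "t \<approx> u \<equiv> derivable E t u"

definition below (infix \<open>\<sqsubseteq>\<close> 50) where
  "t \<sqsubseteq> u \<longleftrightarrow> t \<oplus> u \<approx> u"

declare derivable.trans [trans]

section \<open>Arbitrary instances of the axioms\<close>

lemma obtain_enumeration:
  obtains v :: "nat \<Rightarrow> 'v" where "inj v"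
  using infinite_countable_subset[OF infinite_variables] by auto

lemma obtain_instance:
  obtains x y z :: 'v and \<sigma> :: "'v \<Rightarrow> ('a, 'v) bccs"
  where "distinct [x, y, z]" "\<sigma> x = t" "\<sigma> y = u" "\<sigma> z = v"
proof -
  obtain f :: "nat \<Rightarrow> 'v" where f: "inj f"
    by (rule obtain_enumeration)
  let ?\<sigma> = "(\<lambda>_. Zero)(f 0 := t, f 1 := u, f 2 := v)"
  show thesis
    by (rule that[of "f 0" "f 1" "f 2" ?\<sigma>]) (use f in \<open>auto simp: inj_eq\<close>)
qed

lemma plus_comm: "t \<oplus> u \<approx> u \<oplus> t"
proof -
  obtain x y z :: 'v and \<sigma> where *: "distinct [x, y, z]" "\<sigma> x = t" "\<sigma> y = u" "\<sigma> z = Zero"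
    by (rule obtain_instance)
  then have "(Var x \<oplus> Var y, Var y \<oplus> Var x) \<in> E"
    using WF_axioms_subset by (auto simp: WF_axioms_def A1_def)
  from derivable.inst[OF this, of \<sigma>] * show ?thesis
    by simp
qed

lemma plus_assoc: "(t \<oplus> u) \<oplus> v \<approx> t \<oplus> (u \<oplus> v)"
proof -
  obtain x y z :: 'v and \<sigma> where *: "distinct [x, y, z]" "\<sigma> x = t" "\<sigma> y = u" "\<sigma> z = v"
    by (rule obtain_instance)
  then have "((Var x \<oplus> Var y) \<oplus> Var z, Var x \<oplus> (Var y \<oplus> Var z)) \<in> E"
    using WF_axioms_subset by (auto simp: WF_axioms_def A2_def)
  from derivable.inst[OF this, of \<sigma>] * show ?thesis
    by simp
qed

lemma plus_idem: "t \<oplus> t \<approx> t"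
proof -
  have "(Var x \<oplus> Var x, Var x) \<in> E" for x
    using WF_axioms_subset by (auto simp: WF_axioms_def A3_def)
  from derivable.inst[OF this, of "\<lambda>_. t"] show ?thesis
    by simp
qed

lemma plus_Zero: "t \<oplus> Zero \<approx> t"
proof -
  have "(Var x \<oplus> Zero, Var x) \<in> E" for x
    using WF_axioms_subset by (auto simp: WF_axioms_def A4_def)
  from derivable.inst[OF this, of "\<lambda>_. t"] show ?thesis
    by simp
qed

lemma pref_taus: "\<alpha> \<cdot> (Tau \<cdot> t \<oplus> Tau \<cdot> u) \<approx> \<alpha> \<cdot> t \<oplus> \<alpha> \<cdot> u"
proof -
  obtain x y z :: 'v and \<sigma> where *: "distinct [x, y, z]" "\<sigma> x = t" "\<sigma> y = u" "\<sigma> z = Zero"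
    by (rule obtain_instance)
  then have "(\<alpha> \<cdot> (Tau \<cdot> Var x \<oplus> Tau \<cdot> Var y), \<alpha> \<cdot> Var x \<oplus> \<alpha> \<cdot> Var y) \<in> E"
    using WF_axioms_subset by (auto simp: WF_axioms_def WIF1_def)
  from derivable.inst[OF this, of \<sigma>] * show ?thesis
    by simp
qed

lemma tau_plus: "Tau \<cdot> t \<oplus> u \<approx> Tau \<cdot> t \<oplus> Tau \<cdot> (t \<oplus> u)"
proof -
  obtain x y z :: 'v and \<sigma> where *: "distinct [x, y, z]" "\<sigma> x = t" "\<sigma> y = u" "\<sigma> z = Zero"
    by (rule obtain_instance)
  then have "(Tau \<cdot> Var x \<oplus> Var y, Tau \<cdot> Var x \<oplus> Tau \<cdot> (Var x \<oplus> Var y)) \<in> E"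
    using WF_axioms_subset by (auto simp: WF_axioms_def WIF2_def)
  from derivable.inst[OF this, of \<sigma>] * show ?thesis
    by simp
qed

lemma act_plus_tau:
  "Act a \<cdot> t \<oplus> Tau \<cdot> (Act a \<cdot> u \<oplus> v) \<approx> Tau \<cdot> (Act a \<cdot> t \<oplus> Act a \<cdot> u \<oplus> v)"
proof -
  obtain x y z :: 'v and \<sigma> where *: "distinct [x, y, z]" "\<sigma> x = t" "\<sigma> y = u" "\<sigma> z = v"
    by (rule obtain_instance)
  then have "(Act a \<cdot> Var x \<oplus> Tau \<cdot> (Act a \<cdot> Var y \<oplus> Var z),
      Tau \<cdot> (Act a \<cdot> Var x \<oplus> Act a \<cdot> Var y \<oplus> Var z)) \<in> E"
    using WF_axioms_subset by (auto simp: WF_axioms_def WFE_def)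
  from derivable.inst[OF this, of \<sigma>] * show ?thesis
    by simp
qed

section \<open>The derivable order\<close>

lemma plus_congL: "t \<approx> u \<Longrightarrow> t \<oplus> v \<approx> u \<oplus> v"
  by (rule derivable.cong_Plus[OF _ derivable.refl])

lemma plus_congR: "t \<approx> u \<Longrightarrow> v \<oplus> t \<approx> v \<oplus> u"
  by (rule derivable.cong_Plus[OF derivable.refl])

lemma below_refl [simp]: "t \<sqsubseteq> t"
  by (simp add: below_def plus_idem)

lemma below_eqvL: "t \<approx> u \<Longrightarrow> u \<sqsubseteq> v \<Longrightarrow> t \<sqsubseteq> v"
  unfolding below_def by (blast intro: derivable.trans plus_congL)

lemma below_eqvR: "t \<sqsubseteq> u \<Longrightarrow> u \<approx> v \<Longrightarrow> t \<sqsubseteq> v"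
  unfolding below_def by (blast intro: derivable.trans derivable.sym plus_congR)

lemma below_antisym: "t \<sqsubseteq> u \<Longrightarrow> u \<sqsubseteq> t \<Longrightarrow> t \<approx> u"
  unfolding below_def by (blast intro: derivable.trans derivable.sym plus_comm)

lemma below_trans [trans]:
  assumes "t \<sqsubseteq> u" "u \<sqsubseteq> v"
  shows "t \<sqsubseteq> v"
proof -
  have "t \<oplus> v \<approx> t \<oplus> (u \<oplus> v)"
    using assms(2) unfolding below_def by (rule plus_congR[OF derivable.sym])
  also have "\<dots> \<approx> (t \<oplus> u) \<oplus> v"
    by (rule derivable.sym[OF plus_assoc])
  also have "\<dots> \<approx> u \<oplus> v"
    using assms(1) unfolding below_def by (rule plus_congL)
  also have "\<dots> \<approx> v"
    using assms(2) unfolding below_def .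
  finally show ?thesis
    unfolding below_def .
qed

lemmas [trans] = below_eqvL below_eqvR

lemma below_plusL: "t \<sqsubseteq> t \<oplus> u"
  unfolding below_def
  by (rule derivable.trans[OF derivable.sym[OF plus_assoc] plus_congL[OF plus_idem]])

lemma below_plusR: "u \<sqsubseteq> t \<oplus> u"
  by (rule below_eqvR[OF below_plusL plus_comm])

lemma plus_below:
  assumes "t \<sqsubseteq> v" "u \<sqsubseteq> v"
  shows "t \<oplus> u \<sqsubseteq> v"
proof -
  have "(t \<oplus> u) \<oplus> v \<approx> t \<oplus> (u \<oplus> v)"
    by (rule plus_assoc)
  also have "\<dots> \<approx> t \<oplus> v"
    using assms(2) unfolding below_def by (rule plus_congR)
  also have "\<dots> \<approx> v"
    using assms(1) unfolding below_def .
  finally show ?thesis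
    unfolding below_def .
qed

lemma plus_below_iff: "t \<oplus> u \<sqsubseteq> v \<longleftrightarrow> t \<sqsubseteq> v \<and> u \<sqsubseteq> v"
  by (meson below_plusL below_plusR below_trans plus_below)

lemma below_plus: "t \<sqsubseteq> u \<or> t \<sqsubseteq> v \<Longrightarrow> t \<sqsubseteq> u \<oplus> v"
  by (meson below_plusL below_plusR below_trans)

lemma Zero_below: "Zero \<sqsubseteq> t"
  unfolding below_def by (rule derivable.trans[OF plus_comm plus_Zero])

lemma step_below: "step t \<alpha> t' \<Longrightarrow> \<alpha> \<cdot> t' \<sqsubseteq> t"
  by (induction rule: step.induct) (auto intro: below_plus)

lemma topvars_below: "x \<in> topvars t \<Longrightarrow> Var x \<sqsubseteq> t"
  by (induction t) (auto intro: below_plus)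

text \<open>A term is a sum of its unguarded variables and its prefixed derivatives, so an upper
  bound can be checked summand by summand, without normal forms.\<close>

lemma below_if_summands_below:
  "\<lbrakk>\<And>x. x \<in> topvars t \<Longrightarrow> Var x \<sqsubseteq> u; \<And>\<alpha> t'. step t \<alpha> t' \<Longrightarrow> \<alpha> \<cdot> t' \<sqsubseteq> u\<rbrakk> \<Longrightarrow> t \<sqsubseteq> u"
  by (induction t) (auto simp: Zero_below plus_below)

section \<open>Laws for \<open>Tau\<close> prefixes and internal choice\<close>

lemma below_tau: "t \<sqsubseteq> Tau \<cdot> t"
proof -
  have "t \<sqsubseteq> Tau \<cdot> t \<oplus> t"
    by (rule below_plusR)
  also have "\<dots> \<approx> Tau \<cdot> t \<oplus> Tau \<cdot> (t \<oplus> t)"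
    by (rule tau_plus)
  also have "\<dots> \<approx> Tau \<cdot> t \<oplus> Tau \<cdot> t"
    by (intro plus_congR derivable.cong_Pref plus_idem)
  also have "\<dots> \<approx> Tau \<cdot> t"
    by (rule plus_idem)
  finally show ?thesis .
qed

lemma taus_below: "taus t t' \<Longrightarrow> Tau \<cdot> t' \<sqsubseteq> Tau \<cdot> t"
  unfolding taus_def
  by (induction rule: rtranclp_induct) (simp, meson below_tau below_trans step_below)

lemma tau_plus_below:
  assumes "Tau \<cdot> t \<sqsubseteq> v" "u \<sqsubseteq> v"
  shows "Tau \<cdot> (t \<oplus> u) \<sqsubseteq> v"
proof -
  have "Tau \<cdot> (t \<oplus> u) \<sqsubseteq> Tau \<cdot> t \<oplus> Tau \<cdot> (t \<oplus> u)"
    by (rule below_plusR)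
  also have "\<dots> \<approx> Tau \<cdot> t \<oplus> u"
    by (rule derivable.sym[OF tau_plus])
  also have "\<dots> \<sqsubseteq> v"
    using assms by (rule plus_below)
  finally show ?thesis .
qed

text \<open>Given a \<open>Tau\<close> summand of \<open>t\<close>, \<open>WIF2\<close> rewrites
  \<open>t\<close> as a sum of \<open>Tau\<close> prefixes, and \<open>WIF1\<close> removes an outer
  \<open>Tau\<close> from such a sum.\<close>

lemma tau_unstable:
  assumes "\<not> stable t"
  shows "Tau \<cdot> t \<approx> t"
proof -
  obtain t' where "step t Tau t'"
    using assms by (auto simp: stable_def)
  then have t: "Tau \<cdot> t' \<oplus> t \<approx> t"
    using step_below unfolding below_def by blast
  have "Tau \<cdot> t \<approx> Tau \<cdot> (Tau \<cdot> t' \<oplus> t)"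
    by (intro derivable.cong_Pref derivable.sym[OF t])
  also have "\<dots> \<approx> Tau \<cdot> (Tau \<cdot> t' \<oplus> Tau \<cdot> (t' \<oplus> t))"
    by (intro derivable.cong_Pref tau_plus)
  also have "\<dots> \<approx> Tau \<cdot> t' \<oplus> Tau \<cdot> (t' \<oplus> t)"
    by (rule pref_taus)
  also have "\<dots> \<approx> Tau \<cdot> t' \<oplus> t"
    by (rule derivable.sym[OF tau_plus])
  also have "\<dots> \<approx> t"
    by (rule t)
  finally show ?thesis .
qed

lemma pref_tau: "\<alpha> \<cdot> Tau \<cdot> t \<approx> \<alpha> \<cdot> t"
proof -
  have "\<alpha> \<cdot> Tau \<cdot> t \<approx> \<alpha> \<cdot> (Tau \<cdot> t \<oplus> Tau \<cdot> t)"
    by (intro derivable.cong_Pref derivable.sym[OF plus_idem])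
  also have "\<dots> \<approx> \<alpha> \<cdot> t \<oplus> \<alpha> \<cdot> t"
    by (rule pref_taus)
  also have "\<dots> \<approx> \<alpha> \<cdot> t"
    by (rule plus_idem)
  finally show ?thesis .
qed

text \<open>\<open>WIF1\<close> gathers both prefixes into one over an internal choice, where the
  premise applies.\<close>

lemma pref_mono_tau:
  assumes "Tau \<cdot> t \<sqsubseteq> Tau \<cdot> u"
  shows "\<alpha> \<cdot> t \<sqsubseteq> \<alpha> \<cdot> u"
proof -
  have "\<alpha> \<cdot> t \<oplus> \<alpha> \<cdot> u \<approx> \<alpha> \<cdot> (Tau \<cdot> t \<oplus> Tau \<cdot> u)"
    by (rule derivable.sym[OF pref_taus])
  also have "\<dots> \<approx> \<alpha> \<cdot> Tau \<cdot> u"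
    using assms unfolding below_def by (rule derivable.cong_Pref)
  also have "\<dots> \<approx> \<alpha> \<cdot> u"
    by (rule pref_tau)
  finally show ?thesis
    unfolding below_def .
qed

definition tau_sum :: "('a, 'v) bccs list \<Rightarrow> ('a, 'v) bccs" where
  "tau_sum ts = sum_terms (map (\<lambda>t. Tau \<cdot> t) ts)"

lemma step_tau_sum: "t \<in> set ts \<Longrightarrow> step (tau_sum ts) Tau t"
  by (auto simp: tau_sum_def step_sum_terms)

text \<open>Iterated \<open>WIF1\<close>. For the empty list the sum is \<open>Zero\<close>, and the
  assumption would say nothing about \<open>\<alpha> \<cdot> Zero\<close>.\<close>

lemma pref_tau_sum_below:
  "ts \<noteq> [] \<Longrightarrow> (\<And>t. t \<in> set ts \<Longrightarrow> \<alpha> \<cdot> t \<sqsubseteq> u) \<Longrightarrow> \<alpha> \<cdot> tau_sum ts \<sqsubseteq> u"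
proof (induction ts rule: list_nonempty_induct)
  case (single t)
  have "\<alpha> \<cdot> tau_sum [t] \<approx> \<alpha> \<cdot> Tau \<cdot> t"
    by (simp add: tau_sum_def sum_terms_def plus_Zero derivable.cong_Pref)
  also have "\<dots> \<approx> \<alpha> \<cdot> t"
    by (rule pref_tau)
  also have "\<dots> \<sqsubseteq> u"
    using single by simp
  finally show ?case .
next
  case (cons t ts)
  obtain t' where "t' \<in> set ts"
    using cons.hyps by (cases ts) auto
  \<comment> \<open>\<open>WIF1\<close> needs a \<open>Tau\<close> prefix on the tail too; since the
    tail is unstable, it may be given one.\<close>
  then have unstable: "\<not> stable (tau_sum ts)"
    using step_tau_sum unfolding stable_def by blast
  have "\<alpha> \<cdot> tau_sum (t # ts) = \<alpha> \<cdot> (Tau \<cdot> t \<oplus> tau_sum ts)"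
    by (simp add: tau_sum_def sum_terms_def)
  also have "\<dots> \<approx> \<alpha> \<cdot> (Tau \<cdot> t \<oplus> Tau \<cdot> tau_sum ts)"
    by (intro derivable.cong_Pref plus_congR derivable.sym[OF tau_unstable[OF unstable]])
  also have "\<dots> \<approx> \<alpha> \<cdot> t \<oplus> \<alpha> \<cdot> tau_sum ts"
    by (rule pref_taus)
  also have "\<dots> \<sqsubseteq> u"
    using cons by (intro plus_below) auto
  finally show ?case .
qed

text \<open>Stability leaves only variables and visible prefixes in \<open>u\<close>.
  \<open>WFE\<close> moves a prefix under \<open>Tau\<close> if \<open>t\<close> has a summand with
  the same action; a variable of \<open>t\<close> is absorbed on either side.\<close>

lemma tau_plus_absorb:
  assumes "stable u" "initials u \<subseteq> initials t" "topvars u \<subseteq> topvars t"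
  shows "Tau \<cdot> t \<oplus> u \<approx> Tau \<cdot> (t \<oplus> u)"
  using assms
proof (induction u arbitrary: t)
  case Zero
  show ?case
    by (rule derivable.trans[OF plus_Zero derivable.sym[OF derivable.cong_Pref[OF plus_Zero]]])
next
  case (Var x)
  then have x: "Var x \<sqsubseteq> t"
    by (simp add: topvars_below)
  have "Var x \<sqsubseteq> Tau \<cdot> t"
    by (rule below_trans[OF x below_tau])
  then have "Tau \<cdot> t \<oplus> Var x \<approx> Tau \<cdot> t"
    unfolding below_def by (rule derivable.trans[OF plus_comm])
  also have "\<dots> \<approx> Tau \<cdot> (t \<oplus> Var x)"
    using x unfolding below_def
    by (intro derivable.cong_Pref derivable.sym[OF derivable.trans[OF plus_comm]])
  finally show ?case .
next
  case (Pref \<alpha> u)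
  then obtain a where a: "\<alpha> = Act a"
    by (cases \<alpha>) auto
  with Pref obtain t' where "step t (Act a) t'"
    by (auto simp: initials_def)
  then have t: "Act a \<cdot> t' \<oplus> t \<approx> t"
    using step_below unfolding below_def by blast
  have "Tau \<cdot> t \<oplus> Act a \<cdot> u \<approx> Act a \<cdot> u \<oplus> Tau \<cdot> t"
    by (rule plus_comm)
  also have "\<dots> \<approx> Act a \<cdot> u \<oplus> Tau \<cdot> (Act a \<cdot> t' \<oplus> t)"
    by (intro plus_congR derivable.cong_Pref derivable.sym[OF t])
  also have "\<dots> \<approx> Tau \<cdot> (Act a \<cdot> u \<oplus> Act a \<cdot> t' \<oplus> t)"
    by (rule act_plus_tau)
  also have "\<dots> \<approx> Tau \<cdot> (t \<oplus> Act a \<cdot> u)"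
    by (intro derivable.cong_Pref)
      (rule derivable.trans[OF plus_assoc derivable.trans[OF plus_congR[OF t] plus_comm]])
  finally show ?case
    by (simp add: a)
next
  case (Plus u1 u2)
  have "Tau \<cdot> t \<oplus> (u1 \<oplus> u2) \<approx> (Tau \<cdot> t \<oplus> u1) \<oplus> u2"
    by (rule derivable.sym[OF plus_assoc])
  also have "\<dots> \<approx> Tau \<cdot> (t \<oplus> u1) \<oplus> u2"
    using Plus by (intro plus_congL Plus.IH) auto
  also have "\<dots> \<approx> Tau \<cdot> ((t \<oplus> u1) \<oplus> u2)"
    using Plus by (intro Plus.IH) auto
  also have "\<dots> \<approx> Tau \<cdot> (t \<oplus> (u1 \<oplus> u2))"
    by (intro derivable.cong_Pref plus_assoc)
  finally show ?case .
qed

text \<open>In \<open>FE3'\<close> put \<open>t\<close> for \<open>x\<close>, \<open>u\<close> for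
  \<open>y\<close>, and a \<open>b\<close>-derivative of \<open>t\<close> for each
  \<open>z b\<close>. Then \<open>t\<close> absorbs the sum over all actions.\<close>

lemma tau_below_tau_plus_if_all_actions:
  assumes "FE3' \<subseteq> E" "finite (UNIV :: 'a set)" "range Act \<subseteq> initials t"
  shows "Tau \<cdot> t \<sqsubseteq> Tau \<cdot> (t \<oplus> u)"
proof -
  obtain v :: "nat \<Rightarrow> 'v" where v: "inj v"
    by (rule obtain_enumeration)
  \<comment> \<open>The shift by 2 keeps \<open>v 0\<close> and \<open>v 1\<close> free for the
    roles of \<open>x\<close> and \<open>y\<close>.\<close>
  define z where "z b = v (to_nat b + 2)" for b :: 'a
  obtain bs where bs: "distinct bs" "set bs = (UNIV :: 'a set)"
    using finite_distinct_list[OF assms(2)] by auto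
  have "\<forall>b. \<exists>t'. step t (Act b) t'"
    using assms(3) by (auto simp: initials_def)
  then obtain r where r: "\<And>b. step t (Act b) (r b)"
    by metis
  define \<sigma> where "\<sigma> x = (if x = v 0 then t else if x = v 1 then u
    else r (from_nat (inv v x - 2)))" for x
  have \<sigma>: "\<sigma> (v 0) = t" "\<sigma> (v 1) = u" "\<sigma> (z b) = r b" for b
    using v by (auto simp: \<sigma>_def z_def inj_eq)
  define p where "p = subst \<sigma> (pref_sum bs z)"
  have p: "p = sum_terms (map (\<lambda>b. Act b \<cdot> r b) bs)"
    by (simp add: p_def pref_sum_def subst_sum_terms \<sigma> comp_def)
  have "p \<sqsubseteq> t"
  proof (rule below_if_summands_below)
    show "\<alpha> \<cdot> p' \<sqsubseteq> t" if "step p \<alpha> p'" for \<alpha> p'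
      using that step_below[OF r] by (auto simp: p step_sum_terms)
  qed (simp add: p topvars_sum_terms)
  then have "t \<oplus> p \<approx> t" "t \<oplus> u \<oplus> p \<approx> t \<oplus> u"
    by (simp_all add: below_antisym plus_below_iff below_plus)
  moreover have "(Tau \<cdot> (Var (v 0) \<oplus> pref_sum bs z) \<oplus>
      Tau \<cdot> (Var (v 0) \<oplus> Var (v 1) \<oplus> pref_sum bs z),
      Tau \<cdot> (Var (v 0) \<oplus> Var (v 1) \<oplus> pref_sum bs z)) \<in> E"
  proof -
    have "inj z" "v 0 \<notin> range z" "v 1 \<notin> range z" "v 0 \<noteq> v 1"
      using v by (auto intro!: injI simp: inj_eq z_def)
    with bs show ?thesis
      using assms(1) by (fastforce simp: FE3'_def)
  qed
  from derivable.inst[OF this, of \<sigma>]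
  have "Tau \<cdot> (t \<oplus> p) \<sqsubseteq> Tau \<cdot> (t \<oplus> u \<oplus> p)"
    by (simp add: \<sigma> below_def p_def del: One_nat_def)
  ultimately show ?thesis
    by (meson below_eqvL below_eqvR derivable.cong_Pref derivable.sym)
qed

end

section \<open>A symbolic failures preorder on open terms\<close>

text \<open>
  The acceptance condition skips states offering every action of \<open>A\<close>: no closed instance can
  reveal which variables such a state offers, and \<open>FE3'\<close> is the equational counterpart of this.
\<close>

definition sym_le :: "('a, 'v) bccs \<Rightarrow> ('a, 'v) bccs \<Rightarrow> bool" where
  "sym_le t u \<longleftrightarrow>
     (\<forall>as s. weak_steps as t s \<longrightarrow>
        (\<exists>s'. weak_steps as u s') \<and>
        (\<forall>x \<in> topvars s. \<exists>s'. weak_steps as u s' \<and> x \<in> topvars s') \<and>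
        (stable s \<and> initials s \<noteq> range Act \<longrightarrow>
           (\<exists>s'. weak_steps as u s' \<and> stable s' \<and>
              initials s' \<subseteq> initials s \<and> topvars s' \<subseteq> topvars s)))"

lemma sym_leD:
  assumes "sym_le t u" "weak_steps as t s"
  shows "\<exists>s'. weak_steps as u s'"
    and "x \<in> topvars s \<Longrightarrow> \<exists>s'. weak_steps as u s' \<and> x \<in> topvars s'"
    and "stable s \<Longrightarrow> initials s \<noteq> range Act \<Longrightarrow>
      \<exists>s'. weak_steps as u s' \<and> stable s' \<and> initials s' \<subseteq> initials s \<and> topvars s' \<subseteq> topvars s"
  using assms unfolding sym_le_def by blast+

lemma sym_le_step_Tau: "sym_le t u \<Longrightarrow> step t Tau t' \<Longrightarrow> sym_le t' u"
  unfolding sym_le_def by (metis taus_refl taus_step weak_steps_taus)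

text \<open>A run of \<open>u\<close> along \<open>a # as\<close> passes through a weak
  \<open>a\<close>-derivative, which \<open>v\<close> reaches silently, so \<open>v\<close> inherits
  the rest of the run.\<close>

lemma sym_le_weak_derivative:
  assumes "sym_le t u" "step t (Act a) t'"
    and v: "\<And>s u'. taus u s \<Longrightarrow> step s (Act a) u' \<Longrightarrow> taus v u'"
  shows "sym_le t' v"
proof -
  have *: "weak_steps as v s'" if "weak_steps (a # as) u s'" for as s'
    using that v by (auto intro: weak_steps_taus)
  show ?thesis
    unfolding sym_le_def
    by (intro allI impI)
      (meson * sym_leD[OF assms(1) weak_steps_step[OF assms(2)]])
qed

text \<open>\<open>v\<close> is the internal choice between all weak \<open>a\<close>-derivatives of
  \<open>u\<close>. Preservation of closedness serves ground completeness.\<close>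

lemma (in wf_theory) ex_derivative_cover:
  assumes "sym_le t u" "step t (Act a) t'"
  obtains v where "sym_le t' v"
    and "\<And>r. (\<And>s u'. taus u s \<Longrightarrow> step s (Act a) u' \<Longrightarrow> Act a \<cdot> u' \<sqsubseteq> r) \<Longrightarrow> Act a \<cdot> v \<sqsubseteq> r"
    and "vars u = {} \<Longrightarrow> vars v = {}"
proof -
  obtain us where us: "set us = {u'. \<exists>s. taus u s \<and> step s (Act a) u'}"
    using finite_list[OF finite_weak_derivatives] by blast
  have "\<exists>s'. weak_steps [a] u s'"
    using sym_leD(1)[OF assms(1) weak_steps_step[OF assms(2), of "[]" t']] by simp
  \<comment> \<open>\<open>u\<close> must match the trace \<open>[a]\<close> of \<open>t\<close>, so
    the choice is not empty.\<close>
  then have "us \<noteq> []"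
    using us by fastforce
  show thesis
  proof (rule that[of "tau_sum us"])
    show "sym_le t' (tau_sum us)"
      using us by (intro sym_le_weak_derivative[OF assms]) (blast intro: taus_step step_tau_sum taus_refl)
    show "Act a \<cdot> tau_sum us \<sqsubseteq> r"
      if "\<And>s u'. taus u s \<Longrightarrow> step s (Act a) u' \<Longrightarrow> Act a \<cdot> u' \<sqsubseteq> r" for r
      using that us \<open>us \<noteq> []\<close> by (intro pref_tau_sum_below) auto
    show "vars (tau_sum us) = {}" if "vars u = {}"
    proof -
      have "vars u' = {}" if "u' \<in> set us" for u'
        using that us \<open>vars u = {}\<close> vars_step vars_taus by blast
      then show ?thesis
        unfolding tau_sum_def sum_terms_def by (induction us) auto
    qed
  qed
qed

text \<open>The alternatives in the second assumption concern a stable \<open>t\<close> that offers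
  all of \<open>A\<close>: this cannot occur for infinite \<open>A\<close>, \<open>FE3'\<close>
  handles it, and a closed \<open>u\<close> has no variables that \<open>t\<close> might
  lack.\<close>

lemma (in wf_theory) sym_le_imp_tau_below:
  assumes "sym_le t u" "infinite (UNIV :: 'a set) \<or> FE3' \<subseteq> E \<or> vars u = {}"
  shows "Tau \<cdot> t \<sqsubseteq> Tau \<cdot> u"
  using assms
proof (induction t arbitrary: u rule: measure_induct_rule[where f = size])
  case (less t)
  have t: "t \<sqsubseteq> Tau \<cdot> u"
  proof (rule below_if_summands_below)
    fix x assume "x \<in> topvars t"
    then obtain s where "taus u s" "x \<in> topvars s"
      using sym_leD(2)[OF less.prems(1), of "[]" t x] by auto
    then show "Var x \<sqsubseteq> Tau \<cdot> u"
      by (meson below_tau below_trans taus_below topvars_below)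
  next
    fix \<alpha> t' assume t': "step t \<alpha> t'"
    show "\<alpha> \<cdot> t' \<sqsubseteq> Tau \<cdot> u"
    proof (cases \<alpha>)
      case Tau
      with t' less show ?thesis
        by (blast intro: size_step sym_le_step_Tau)
    next
      case (Act a)
      with t' have "step t (Act a) t'"
        by simp
      from ex_derivative_cover[OF less.prems(1) this] obtain v where v: "sym_le t' v"
        "\<And>r. (\<And>s u'. taus u s \<Longrightarrow> step s (Act a) u' \<Longrightarrow> Act a \<cdot> u' \<sqsubseteq> r) \<Longrightarrow> Act a \<cdot> v \<sqsubseteq> r"
        "vars u = {} \<Longrightarrow> vars v = {}"
        by blast
      have "Tau \<cdot> t' \<sqsubseteq> Tau \<cdot> v"
        using less v t' by (blast intro: size_step)
      then have "Act a \<cdot> t' \<sqsubseteq> Act a \<cdot> v"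
        by (rule pref_mono_tau)
      also have "\<dots> \<sqsubseteq> Tau \<cdot> u"
        by (rule v(2)) (meson below_tau below_trans step_below taus_below)
      finally show ?thesis
        by (simp add: Act)
    qed
  qed
  show ?case
  proof (cases "stable t")
    case False
    from below_eqvL[OF tau_unstable[OF False] t] show ?thesis .
  next
    case True
    \<comment> \<open>Adding a silent derivative of \<open>u\<close> to \<open>t\<close> stays below
      \<open>Tau \<cdot> u\<close> by \<open>WIF2\<close>; what remains is to drop it again.\<close>
    have *: "Tau \<cdot> (t \<oplus> s) \<sqsubseteq> Tau \<cdot> u" if "taus u s" for s
    proof -
      have "Tau \<cdot> (t \<oplus> s) \<approx> Tau \<cdot> (s \<oplus> t)"
        by (intro derivable.cong_Pref plus_comm)
      also have "\<dots> \<sqsubseteq> Tau \<cdot> u"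
        using that t by (blast intro: tau_plus_below taus_below)
      finally show ?thesis .
    qed
    have absorb: ?thesis
      if s: "taus u s" "stable s" "initials s \<subseteq> initials t" "topvars s \<subseteq> topvars t" for s
    proof -
      have "Tau \<cdot> t \<sqsubseteq> Tau \<cdot> t \<oplus> s"
        by (rule below_plusL)
      also have "\<dots> \<approx> Tau \<cdot> (t \<oplus> s)"
        using s by (intro tau_plus_absorb)
      also have "\<dots> \<sqsubseteq> Tau \<cdot> u"
        using s(1) by (rule *)
      finally show ?thesis .
    qed
    show ?thesis
    proof (cases "initials t = range Act")
      case False
      with sym_leD(3)[OF less.prems(1), of "[]" t] True show ?thesis
        by (auto intro: absorb)
    next
      case all: True
      \<comment> \<open>A term has finitely many initial actions, so offering all of
        \<open>A\<close> forces \<open>A\<close> to be finite.\<close>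
      have fin: "finite (UNIV :: 'a set)"
        using finite_initials[of t] unfolding all by (rule finite_imageD) (simp add: inj_def)
      obtain s where s: "taus u s" "stable s"
        using ex_stable_taus by blast
      show ?thesis
      proof (cases "FE3' \<subseteq> E")
        case True
        have "Tau \<cdot> t \<sqsubseteq> Tau \<cdot> (t \<oplus> s)"
          using True fin all by (intro tau_below_tau_plus_if_all_actions) auto
        also have "\<dots> \<sqsubseteq> Tau \<cdot> u"
          using s(1) by (rule *)
        finally show ?thesis .
      next
        case False
        then have "topvars s = {}"
          using less.prems(2) fin vars_taus[OF s(1)] topvars_subset_vars[of s] by blast
        moreover have "initials s \<subseteq> range Act"
          using s(2) initials_subset_iff[of s "{}"] by simp
        ultimately show ?thesis
          using s all by (intro absorb) auto
      qed
    qed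
  qed
qed

section \<open>Test substitutions\<close>

lemma step_subst: "step t \<alpha> t' \<Longrightarrow> step (subst \<rho> t) \<alpha> (subst \<rho> t')"
  by (induction rule: step.induct) auto

lemma taus_subst: "taus t t' \<Longrightarrow> taus (subst \<rho> t) (subst \<rho> t')"
  unfolding taus_def
  by (induction rule: rtranclp_induct) (auto intro: rtranclp.rtrancl_into_rtrancl step_subst)

lemma weak_steps_subst: "weak_steps as t t' \<Longrightarrow> weak_steps as (subst \<rho> t) (subst \<rho> t')"
  by (induction as arbitrary: t) (auto intro: taus_subst, blast intro: taus_subst step_subst)

lemma initials_subst: "initials (subst \<rho> t) = initials t \<union> (\<Union>x \<in> topvars t. initials (\<rho> x))"
  by (induction t) auto

lemma step_subst_cases:
  "step (subst \<rho> t) \<alpha> s \<Longrightarrow>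
     (\<exists>t'. step t \<alpha> t' \<and> s = subst \<rho> t') \<or> (\<exists>x \<in> topvars t. step (\<rho> x) \<alpha> s)"
  by (induction t) auto

lemma taus_subst_cases:
  assumes "\<And>x. stable (\<rho> x)" "taus (subst \<rho> t) s"
  shows "\<exists>t'. taus t t' \<and> s = subst \<rho> t'"
  using assms(2) unfolding taus_def
proof (induction rule: rtranclp_induct)
  case (step s s')
  then obtain t' where t': "(\<lambda>s s'. step s Tau s')\<^sup>*\<^sup>* t t'" "s = subst \<rho> t'"
    by blast
  with step have "step (subst \<rho> t') Tau s'"
    by simp
  then obtain t'' where "step t' Tau t''" "s' = subst \<rho> t''"
    using step_subst_cases assms(1) by (metis stable_def)
  with t' show ?case
    by (blast intro: rtranclp.rtrancl_into_rtrancl)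
qed auto

text \<open>A run of an instance follows \<open>t\<close> until it possibly enters some
  \<open>\<rho> x\<close>. As \<open>\<rho> x\<close> is stable, it is entered by a visible action,
  whence \<open>as2 \<noteq> []\<close>.\<close>

lemma weak_steps_subst_cases:
  assumes "\<And>x. stable (\<rho> x)"
  shows "weak_steps as (subst \<rho> t) s \<Longrightarrow>
    (\<exists>t'. weak_steps as t t' \<and> s = subst \<rho> t') \<or>
    (\<exists>as1 as2 t' x. as = as1 @ as2 \<and> as2 \<noteq> [] \<and> weak_steps as1 t t' \<and> x \<in> topvars t' \<and>
       weak_steps as2 (\<rho> x) s)"
proof (induction as arbitrary: t)
  case Nil
  then show ?case
    using taus_subst_cases[OF assms] by auto
next
  case (Cons a as)
  then obtain t1 s2 where t1: "taus t t1" "step (subst \<rho> t1) (Act a) s2" "weak_steps as s2 s"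
    using taus_subst_cases[OF assms] by force
  from step_subst_cases[OF t1(2)] show ?case
  proof
    assume "\<exists>t'. step t1 (Act a) t' \<and> s2 = subst \<rho> t'"
    then obtain t2 where t2: "step t1 (Act a) t2" "s2 = subst \<rho> t2"
      by blast
    have *: "weak_steps (a # bs) t t'" if "weak_steps bs t2 t'" for bs t'
      using that t1 t2 by auto
    from Cons.IH t1(3) t2(2) consider t' where "weak_steps as t2 t'" "s = subst \<rho> t'"
      | as1 as2 t' x where "as = as1 @ as2" "as2 \<noteq> []" "weak_steps as1 t2 t'" "x \<in> topvars t'"
        "weak_steps as2 (\<rho> x) s"
      by blast
    then show ?thesis
    proof cases
      case 1
      with * show ?thesis by blast
    next
      case 2
      then show ?thesis
        by (intro disjI2 exI[of _ "a # as1"] exI[of _ as2]) (auto dest: * simp del: weak_steps.simps)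
    qed
  next
    assume "\<exists>x \<in> topvars t1. step (\<rho> x) (Act a) s2"
    then obtain x where x: "x \<in> topvars t1" "step (\<rho> x) (Act a) s2"
      by blast
    then have "weak_steps (a # as) (\<rho> x) s"
      using t1(3) by (blast intro: weak_steps_step)
    moreover have "weak_steps [] t t1"
      using t1(1) by simp
    ultimately show ?thesis
      using x(1) by (metis append_Nil list.distinct(1))
  qed
qed

primrec act_power :: "'a \<Rightarrow> nat \<Rightarrow> ('a, 'v) bccs" where
  "act_power c 0 = Zero"
| "act_power c (Suc n) = Act c \<cdot> act_power c n"

lemma stable_act_power [simp]: "stable (act_power c n)"
  by (cases n) auto

lemma closed_act_power [simp]: "vars (act_power c n) = {}"
  by (induction n) auto

lemma initials_act_power: "initials (act_power c n) = (if n = 0 then {} else {Act c})"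
  by (cases n) auto

lemma weak_steps_act_power:
  "weak_steps as (act_power c n) s \<longleftrightarrow>
     (\<exists>k \<le> n. as = replicate k c \<and> s = act_power c (n - k))"
proof (induction as arbitrary: n)
  case Nil
  show ?case
    by (auto simp: taus_stable)
next
  case (Cons a as)
  show ?case
  proof (cases n)
    case (Suc m)
    then have "weak_steps (a # as) (act_power c n) s \<longleftrightarrow> a = c \<and> weak_steps as (act_power c m) s"
      by (auto simp: taus_stable)
    also have "\<dots> \<longleftrightarrow> (\<exists>k \<le> n. a # as = replicate k c \<and> s = act_power c (n - k))"
      unfolding Cons.IH Suc
    proof safe
      fix k assume "k \<le> m"
      then show "\<exists>k' \<le> Suc m. c # replicate k c = replicate k' c \<and>
          act_power c (m - k) = act_power c (Suc m - k')"
        by (intro exI[of _ "Suc k"]) auto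
    next
      fix k assume "k \<le> Suc m" "a # as = replicate k c"
      then show "a = c" "\<exists>k'\<le>m. as = replicate k' c \<and>
          act_power c (Suc m - k) = act_power c (m - k')"
        by (cases k; force)+
    qed
    finally show ?thesis .
  qed (auto simp: taus_stable)
qed

section \<open>Distinguishing open terms by closed instances\<close>

lemma ex_weak_steps_if_wf_eq:
  assumes "wf_eq t u" "weak_steps as (subst \<rho> t) s" "closed_subst \<rho>" "stable s"
  obtains s' where "weak_steps as (subst \<rho> u) s'" "initials s' \<subseteq> initials s"
proof -
  \<comment> \<open>The largest refusal set of \<open>s\<close> is chosen, so that a matching state
    offers only actions of \<open>s\<close>.\<close>
  have "initials s \<subseteq> Act ` (UNIV - {b. Act b \<notin> initials s})"
    using assms(4) by (auto simp: initials_subset_iff)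
  with assms(2) have "(as, {b. Act b \<notin> initials s}) \<in> weak_failures (subst \<rho> t)"
    unfolding weak_failures_def by blast
  with assms(1,3) have "(as, {b. Act b \<notin> initials s}) \<in> weak_failures (subst \<rho> u)"
    by (auto simp: wf_eq_def wf_kernel_iff)
  with that show thesis
    by (auto simp: weak_failures_def)
qed

lemma wf_eq_imp_sym_le:
  fixes t u :: "('a, 'v) bccs"
  assumes "wf_eq t u"
  shows "sym_le t u"
  unfolding sym_le_def
proof (intro allI impI conjI ballI)
  fix as s assume s: "weak_steps as t s"
  \<comment> \<open>With \<open>Zero\<close> for all variables, no visible action stems from a
    variable, so a trace of the instance is a trace of \<open>u\<close> itself.\<close>
  define \<rho> :: "'v \<Rightarrow> ('a, 'v) bccs" where "\<rho> = (\<lambda>_. Zero)"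
  obtain s1 where s1: "taus (subst \<rho> s) s1" "stable s1"
    using ex_stable_taus by blast
  have "weak_steps (as @ []) (subst \<rho> t) s1"
    using weak_steps_subst[OF s] s1(1) by (intro weak_steps_append) auto
  then obtain s' where "weak_steps as (subst \<rho> u) s'"
    using ex_weak_steps_if_wf_eq[OF assms _ _ s1(2), of as \<rho>]
    by (auto simp: closed_subst_def closed_term_def \<rho>_def)
  from weak_steps_subst_cases[OF _ this] show "\<exists>s'. weak_steps as u s'"
    by (auto simp: \<rho>_def neq_Nil_conv taus_stable)
next
  fix as s x assume s: "weak_steps as t s" "x \<in> topvars s"
  define c :: 'a where "c = undefined"
  \<comment> \<open>More actions than \<open>u\<close> can perform on its own, so a matching run has
    to enter the image of a variable.\<close>
  define m where "m = Suc (size u)"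
  define \<rho> :: "'v \<Rightarrow> ('a, 'v) bccs" where "\<rho> y = act_power c (if y = x then m else 0)" for y
  have "weak_steps (replicate m c) (subst \<rho> s) Zero"
  proof -
    have "step (subst \<rho> s) (Act c) p" if "step (\<rho> x) (Act c) p" for p
      using s(2) that by (induction s) auto
    then have "step (subst \<rho> s) (Act c) (act_power c (size u))"
      by (simp add: \<rho>_def m_def)
    moreover have "weak_steps (replicate (size u) c) (act_power c (size u)) Zero"
      by (auto simp: weak_steps_act_power)
    ultimately show ?thesis
      unfolding m_def replicate_Suc by (rule weak_steps_step)
  qed
  with weak_steps_subst[OF s(1)] have "weak_steps (as @ replicate m c) (subst \<rho> t) Zero"
    by (rule weak_steps_append)
  then obtain s' where s': "weak_steps (as @ replicate m c) (subst \<rho> u) s'" "initials s' = {}"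
    using ex_weak_steps_if_wf_eq[OF assms, of _ \<rho> Zero]
    by (auto simp: closed_subst_def closed_term_def \<rho>_def)
  have "stable (\<rho> y)" for y
    by (simp add: \<rho>_def)
  from weak_steps_subst_cases[OF this s'(1)] show "\<exists>s'. weak_steps as u s' \<and> x \<in> topvars s'"
  proof (elim disjE exE conjE)
    fix u' assume "weak_steps (as @ replicate m c) u u'"
    from weak_steps_length[OF this] show ?thesis
      by (simp add: m_def)
  next
    fix as1 as2 u' y
    assume u': "as @ replicate m c = as1 @ as2" "as2 \<noteq> []" "weak_steps as1 u u'" "y \<in> topvars u'"
      and "weak_steps as2 (\<rho> y) s'"
    then obtain k where k: "k \<le> (if y = x then m else 0)" "as2 = replicate k c"
      "s' = act_power c ((if y = x then m else 0) - k)"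
      unfolding \<rho>_def weak_steps_act_power by blast
    \<comment> \<open>Since \<open>as2\<close> is nonempty, the image of \<open>y\<close> is not
      \<open>Zero\<close>, so \<open>y = x\<close>. Since the final state offers nothing, the whole
      power was consumed, and thus \<open>as1 = as\<close>.\<close>
    with u'(2) s'(2) have "y = x" "as2 = replicate m c"
      by (auto simp: initials_act_power split: if_splits)
    with u' show ?thesis
      by auto
  qed
next
  fix as s assume s: "weak_steps as t s" "stable s \<and> initials s \<noteq> range Act"
  then obtain c where c: "Act c \<notin> initials s"
    using initials_subset_iff[of s "{}"] by auto
  \<comment> \<open>One more than \<open>as\<close> can consume: a run that enters a power still
    offers \<open>c\<close> at its end, which \<open>s\<close> does not.\<close>
  define m where "m = Suc (length as)"
  \<comment> \<open>Variables offered by \<open>s\<close> vanish, so the instance of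
    \<open>s\<close> offers exactly what \<open>s\<close> does; any other variable betrays itself by
    \<open>c\<close>.\<close>
  define \<rho> :: "'v \<Rightarrow> ('a, 'v) bccs" where
    "\<rho> y = act_power c (if y \<in> topvars s then 0 else m)" for y
  have init: "initials (subst \<rho> s) = initials s"
    by (auto simp: initials_subst \<rho>_def)
  then have st: "stable (subst \<rho> s)"
    using s(2) by (simp add: stable_iff_initials)
  have closed: "closed_subst \<rho>"
    by (simp add: closed_subst_def closed_term_def \<rho>_def)
  obtain s' where s': "weak_steps as (subst \<rho> u) s'" "initials s' \<subseteq> initials s"
    by (rule ex_weak_steps_if_wf_eq[OF assms weak_steps_subst[OF s(1)] closed st, unfolded init])
  have "stable (\<rho> y)" for y
    by (simp add: \<rho>_def)
  from weak_steps_subst_cases[OF this s'(1)]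
  show "\<exists>s'. weak_steps as u s' \<and> stable s' \<and> initials s' \<subseteq> initials s \<and> topvars s' \<subseteq> topvars s"
  proof (elim disjE exE conjE)
    fix u' assume u': "weak_steps as u u'" "s' = subst \<rho> u'"
    with s' have sub: "initials u' \<union> (\<Union>x \<in> topvars u'. initials (\<rho> x)) \<subseteq> initials s"
      by (simp add: initials_subst)
    have "topvars u' \<subseteq> topvars s"
    proof
      fix y assume "y \<in> topvars u'"
      with sub have "initials (\<rho> y) \<subseteq> initials s"
        by blast
      with c show "y \<in> topvars s"
        by (auto simp: \<rho>_def m_def split: if_splits)
    qed
    with u'(1) sub s(2) show ?thesis
      unfolding stable_iff_initials by blast
  next
    fix as1 as2 u' y
    assume as: "as = as1 @ as2" "as2 \<noteq> []" and "weak_steps as2 (\<rho> y) s'"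
    then obtain k where k: "k \<le> (if y \<in> topvars s then 0 else m)" "as2 = replicate k c"
      "s' = act_power c ((if y \<in> topvars s then 0 else m) - k)"
      unfolding \<rho>_def weak_steps_act_power by blast
    with as have "initials s' = {Act c}"
      by (auto simp: initials_act_power m_def split: if_splits)
    with s'(2) c show ?thesis
      by simp
  qed
qed

text \<open>Substituting \<open>Tau \<cdot> Zero\<close> for \<open>x\<close> turns an unguarded
  \<open>x\<close> into instability, which the equivalence detects.\<close>

lemma wf_eq_topvars_subset:
  fixes t u :: "('a, 'v) bccs"
  assumes "wf_eq t u" "stable u"
  shows "topvars t \<subseteq> topvars u"
proof
  fix x assume x: "x \<in> topvars t"
  define \<rho> :: "'v \<Rightarrow> ('a, 'v) bccs" where "\<rho> y = (if y = x then Tau \<cdot> Zero else Zero)" for y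
  have "wf_kernel (subst \<rho> t) (subst \<rho> u)"
    using assms(1) by (auto simp: wf_eq_def closed_subst_def closed_term_def \<rho>_def)
  moreover have "\<not> stable (subst \<rho> t)"
    using x by (auto simp: stable_iff_initials initials_subst \<rho>_def)
  ultimately have "Tau \<in> initials (subst \<rho> u)"
    by (simp add: wf_kernel_iff stable_iff_initials)
  with assms(2) show "x \<in> topvars u"
    by (auto simp: stable_iff_initials initials_subst \<rho>_def split: if_splits)
qed

lemma wf_eq_sym: "wf_eq t u \<Longrightarrow> wf_eq u t"
  by (auto simp: wf_eq_def wf_kernel_def)

lemma wf_eq_stable:
  fixes t u :: "('a, 'v) bccs"
  assumes "wf_eq t u"
  shows "stable t \<longleftrightarrow> stable u"
proof -
  define \<rho> :: "'v \<Rightarrow> ('a, 'v) bccs" where "\<rho> = (\<lambda>_. Zero)"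
  have "stable (subst \<rho> v) \<longleftrightarrow> stable v" for v
    by (simp add: stable_iff_initials initials_subst \<rho>_def)
  moreover have "closed_subst \<rho>"
    by (simp add: closed_subst_def closed_term_def \<rho>_def)
  ultimately show ?thesis
    using assms by (auto simp: wf_eq_def wf_kernel_iff)
qed

section \<open>Completeness\<close>

context wf_theory
begin

text \<open>For unstable terms an outer \<open>Tau\<close> is harmless by
  \<open>tau_unstable\<close>. For stable ones the bound must be \<open>u\<close> rather than
  \<open>Tau \<cdot> u\<close>, so summands are compared directly; \<open>u\<close> then has no
  silent moves before its first action.\<close>

lemma wf_eq_imp_below:
  assumes eq: "wf_eq t u" and cond: "infinite (UNIV :: 'a set) \<or> FE3' \<subseteq> E \<or> vars u = {}"
  shows "t \<sqsubseteq> u"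
proof (cases "stable t")
  case False
  then have "\<not> stable u"
    using wf_eq_stable[OF eq] by simp
  have "t \<sqsubseteq> Tau \<cdot> t"
    by (rule below_tau)
  also have "\<dots> \<sqsubseteq> Tau \<cdot> u"
    using wf_eq_imp_sym_le[OF eq] cond by (rule sym_le_imp_tau_below)
  also have "\<dots> \<approx> u"
    using \<open>\<not> stable u\<close> by (rule tau_unstable)
  finally show ?thesis .
next
  case True
  then have u: "stable u"
    using wf_eq_stable[OF eq] by simp
  show ?thesis
  proof (rule below_if_summands_below)
    fix x assume "x \<in> topvars t"
    then show "Var x \<sqsubseteq> u"
      using wf_eq_topvars_subset[OF eq u] by (auto intro: topvars_below)
  next
    fix \<alpha> t' assume t': "step t \<alpha> t'"
    with True obtain a where a: "\<alpha> = Act a"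
      by (cases \<alpha>) (auto simp: stable_def)
    with t' have "step t (Act a) t'"
      by simp
    from ex_derivative_cover[OF wf_eq_imp_sym_le[OF eq] this] obtain v where v: "sym_le t' v"
      "\<And>r. (\<And>s u'. taus u s \<Longrightarrow> step s (Act a) u' \<Longrightarrow> Act a \<cdot> u' \<sqsubseteq> r) \<Longrightarrow> Act a \<cdot> v \<sqsubseteq> r"
      "vars u = {} \<Longrightarrow> vars v = {}"
      by blast
    have "Tau \<cdot> t' \<sqsubseteq> Tau \<cdot> v"
      using v(1,3) cond by (intro sym_le_imp_tau_below) auto
    then have "Act a \<cdot> t' \<sqsubseteq> Act a \<cdot> v"
      by (rule pref_mono_tau)
    also have "\<dots> \<sqsubseteq> u"
      by (rule v(2)) (auto simp: taus_stable[OF u] intro: step_below)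
    finally show "\<alpha> \<cdot> t' \<sqsubseteq> u"
      by (simp add: a)
  qed
qed

lemma wf_eq_imp_derivable:
  assumes "wf_eq t u" "infinite (UNIV :: 'a set) \<or> FE3' \<subseteq> E \<or> vars t = {} \<and> vars u = {}"
  shows "t \<approx> u"
  using assms wf_eq_sym[OF assms(1)] by (intro below_antisym wf_eq_imp_below) auto

text \<open>Soundness turns derivability of all closed instances into \<open>wf_eq\<close>, from
  which completeness on open terms yields a derivation.\<close>

lemma omega_completeI:
  assumes "sound_WF E" "infinite (UNIV :: 'a set) \<or> FE3' \<subseteq> E"
  shows "omega_complete E"
  unfolding omega_complete_def
proof (intro allI impI)
  fix t u assume *: "\<forall>\<rho>. closed_subst \<rho> \<longrightarrow> derivable E (subst \<rho> t) (subst \<rho> u)"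
  have "wf_eq t u"
    unfolding wf_eq_def
  proof (intro allI impI)
    fix \<rho> :: "'v \<Rightarrow> ('a, 'v) bccs" assume \<rho>: "closed_subst \<rho>"
    with * assms(1) have "wf_eq (subst \<rho> t) (subst \<rho> u)"
      by (auto simp: sound_WF_def)
    \<comment> \<open>A second application of \<open>\<rho>\<close> changes nothing, because the
      images of variables are closed.\<close>
    with \<rho> have "wf_kernel (subst \<rho> (subst \<rho> t)) (subst \<rho> (subst \<rho> u))"
      by (simp add: wf_eq_def)
    moreover have "subst \<rho> (\<rho> x) = \<rho> x" for x
      using \<rho> subst_closed by (auto simp: closed_subst_def)
    ultimately show "wf_kernel (subst \<rho> t) (subst \<rho> u)"
      by (simp add: subst_subst)
  qed
  with assms(2) show "t \<approx> u"
    by (blast intro: wf_eq_imp_derivable)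
qed

text \<open>Closed terms are fixed by every substitution, so \<open>wf_kernel\<close> yields
  \<open>wf_eq\<close>, and closedness supplies the last alternative of
  \<open>wf_eq_imp_derivable\<close>.\<close>

lemma ground_complete: "ground_complete_WF E"
  unfolding ground_complete_WF_def
proof (intro allI impI)
  fix p q :: "('a, 'v) bccs"
  assume "closed_term p" "closed_term q" "wf_kernel p q"
  then show "p \<approx> q"
    by (intro wf_eq_imp_derivable) (auto simp: wf_eq_def subst_closed, auto simp: closed_term_def)
qed

end

theorem theorem4p2:
  assumes "infinite (UNIV :: 'v set)"
  shows
    "sound_WF (WF_axioms :: ('a::countable, 'v) eqns) \<and>
     ground_complete_WF (WF_axioms :: ('a, 'v) eqns) \<and>
     (infinite (UNIV :: 'a set) \<longrightarrow> omega_complete (WF_axioms :: ('a, 'v) eqns)) \<and>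
     (finite (UNIV :: 'a set) \<longrightarrow>
        sound_WF (FE3' :: ('a, 'v) eqns) \<and>
        omega_complete (WF_axioms \<union> FE3' :: ('a, 'v) eqns))"
proof -
  interpret WF: wf_theory "WF_axioms :: ('a, 'v) eqns"
    using assms by unfold_locales auto
  interpret WF': wf_theory "WF_axioms \<union> FE3' :: ('a, 'v) eqns"
    using assms by unfold_locales auto
  have "sound_WF (WF_axioms :: ('a, 'v) eqns)" "sound_WF (FE3' :: ('a, 'v) eqns)"
    "sound_WF (WF_axioms \<union> FE3' :: ('a, 'v) eqns)"
    by (auto intro!: sound_WFI intro: wf_kernel_WF_axioms wf_kernel_FE3')
  then show ?thesis
    using WF.ground_complete WF.omega_completeI WF'.omega_completeI by blast
qed

end
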